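(* For all $n > 0$, $\frac{4}{5}n - \frac{8}{5} \leq \mathcal{G}(K_n, P_4) \leq \frac{4}{5}n + 1$.
   Context: $P_4$ denotes the path on 4 vertices. For a family $\mathcal{F}$ of graphs, a graph is $\mathcal{F}$-free if it contains no member of $\mathcal{F}$ as a subgraph; a subgraph $G \subseteq H$ is $\mathcal{F}$-saturated in $H$ if it is a maximal $\mathcal{F}$-free subgraph of $H$. The $\mathcal{F}$-saturation game $\mathcal{G}(H;\mathcal{F})$: two players, Prolonger and Shortener, alternately add to a graph on $V(H)$, starting from the empty graph, one edge of $H$ not yet present such that the graph remains $\mathcal{F}$-free; the game ends when the graph is $\mathcal{F}$-saturated in $H$. Prolonger aims to maximise and Shortener to minimise the number of edges added (the length of the game); $\mathcal{G}(H;\mathcal{F})$ also denotes this length under optimal play by both players (the game saturation number). The bounds hold regardless of which player moves first. $\mathcal{G}(K_n, P_4)$ means $H = K_n$, $\mathcal{F} = \{P_4\}$. *)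

theory Defs
  imports Complex_Main "HOL-Library.Ramsey"
begin

record 'a graph =
  verts :: "'a set"
  edges :: "'a set set"

definition simple_graph :: "'a graph \<Rightarrow> bool" where
  "simple_graph G \<longleftrightarrow> edges G \<subseteq> [verts G]\<^bsup>2\<^esup>"

definition subgraph :: "'a graph \<Rightarrow> 'a graph \<Rightarrow> bool" where
  "subgraph G H \<longleftrightarrow> simple_graph G \<and> verts G \<subseteq> verts H \<and> edges G \<subseteq> edges H"

definition complete_graph :: "nat \<Rightarrow> nat graph" where
  "complete_graph n = \<lparr>verts = {..<n}, edges = [{..<n}]\<^bsup>2\<^esup>\<rparr>"

definition path_graph :: "nat \<Rightarrow> nat graph" where
  "path_graph k = \<lparr>verts = {..<k}, edges = {{i, Suc i} | i. Suc i < k}\<rparr>"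

text \<open>Containment is up to isomorphism and the copy need not be induced.\<close>

definition contains :: "'a graph \<Rightarrow> 'b graph \<Rightarrow> bool" where
  "contains G F \<longleftrightarrow>
     (\<exists>f. inj_on f (verts F) \<and> f ` verts F \<subseteq> verts G \<and> (\<forall>e\<in>edges F. f ` e \<in> edges G))"

definition family_free :: "'b graph set \<Rightarrow> 'a graph \<Rightarrow> bool" where
  "family_free \<F> G \<longleftrightarrow> (\<forall>F\<in>\<F>. \<not> contains G F)"

definition saturated :: "'b graph set \<Rightarrow> 'a graph \<Rightarrow> 'a graph \<Rightarrow> bool" where
  "saturated \<F> H G \<longleftrightarrow> subgraph G H \<and> family_free \<F> G \<and>
     (\<forall>G'. subgraph G' H \<and> family_free \<F> G' \<and> subgraph G G' \<longrightarrow> G' = G)"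

text \<open>A position of the game on \<open>H\<close> is the set \<open>X\<close> of edges added so far; it stands for
  the graph with these edges on the whole vertex set of \<open>H\<close>.\<close>

definition position :: "'a graph \<Rightarrow> 'a set set \<Rightarrow> 'a graph" where
  "position H X = \<lparr>verts = verts H, edges = X\<rparr>"

definition moves :: "'b graph set \<Rightarrow> 'a graph \<Rightarrow> 'a set set \<Rightarrow> 'a set set" where
  "moves \<F> H X = {e \<in> edges H - X. family_free \<F> (position H (insert e X))}"

datatype player = Prolonger | Shortener

text \<open>\<open>remaining_length \<F> H p X\<close> is the number of edges still to be added under optimal play
  from position \<open>X\<close> with player \<open>p\<close> to move, by backward induction. It is meant for finite
  \<open>H\<close>, and \<open>X\<close> reachable in the game; the test \<open>finite (edges H)\<close> only serves to make the
  function total. In a reachable position that is not saturated, the set of moves is nonempty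
  (lemma \<open>saturated_iff_no_moves\<close>), so that \<open>Max\<close> and \<open>Min\<close> are well-defined.\<close>

function remaining_length ::
  "'b graph set \<Rightarrow> 'a graph \<Rightarrow> player \<Rightarrow> 'a set set \<Rightarrow> nat" where
  "remaining_length \<F> H Prolonger X =
     (if finite (edges H) \<and> \<not> saturated \<F> H (position H X)
      then 1 + Max ((\<lambda>e. remaining_length \<F> H Shortener (insert e X)) ` moves \<F> H X)
      else 0)"
| "remaining_length \<F> H Shortener X =
     (if finite (edges H) \<and> \<not> saturated \<F> H (position H X)
      then 1 + Min ((\<lambda>e. remaining_length \<F> H Prolonger (insert e X)) ` moves \<F> H X)
      else 0)"
  by pat_completeness auto
termination
  by (relation "measure (\<lambda>(\<F>, H, p, X). card (edges H - X))")
     (auto simp: moves_def simp del: card_Diff_insert intro!: psubset_card_mono)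

declare remaining_length.simps [simp del]

definition game_saturation_number ::
  "'a graph \<Rightarrow> 'b graph set \<Rightarrow> player \<Rightarrow> nat" where
  "game_saturation_number H \<F> first_player = remaining_length \<F> H first_player {}"

lemma family_free_antimono:
  assumes "family_free \<F> G'" "verts G \<subseteq> verts G'" "edges G \<subseteq> edges G'"
  shows "family_free \<F> G"
  using assms unfolding family_free_def contains_def by (meson order_trans subsetD)

lemma saturated_iff_no_moves:
  assumes "simple_graph H" "X \<subseteq> edges H" "family_free \<F> (position H X)"
  shows "saturated \<F> H (position H X) \<longleftrightarrow> moves \<F> H X = {}"
proof
  assume sat: "saturated \<F> H (position H X)"
  show "moves \<F> H X = {}"
  proof (rule ccontr)
    assume "moves \<F> H X \<noteq> {}"
    then obtain e where e: "e \<in> edges H" "e \<notin> X" "family_free \<F> (position H (insert e X))"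
      by (auto simp: moves_def)
    moreover have "subgraph (position H (insert e X)) H"
      "subgraph (position H X) (position H (insert e X))"
      using e assms by (auto simp: subgraph_def simple_graph_def position_def)
    ultimately have "position H (insert e X) = position H X"
      using sat unfolding saturated_def by blast
    with e show False by (auto simp: position_def)
  qed
next
  assume none: "moves \<F> H X = {}"
  have "G' = position H X"
    if G': "subgraph G' H" "family_free \<F> G'" "subgraph (position H X) G'" for G'
  proof -
    have v: "verts G' = verts H" and X: "X \<subseteq> edges G'" and E: "edges G' \<subseteq> edges H"
      using G' by (auto simp: subgraph_def position_def)
    have "edges G' \<subseteq> X"
    proof
      fix e assume e: "e \<in> edges G'"
      have "family_free \<F> (position H (insert e X))"
        by (rule family_free_antimono[OF G'(2)]) (use v X e in \<open>auto simp: position_def\<close>)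
      with none e E show "e \<in> X" by (auto simp: moves_def)
    qed
    with v X show ?thesis by (cases G') (auto simp: position_def)
  qed
  with assms show "saturated \<F> H (position H X)"
    unfolding saturated_def by (auto simp: subgraph_def simple_graph_def position_def)
qed

end

theory Submission
  imports Defs
begin

text \<open>The components of a \<open>P\<^sub>4\<close>-free graph are isolated vertices, single edges, paths on three
  vertices, larger stars and triangles, so the game depends only on the numbers \<open>i\<close>, \<open>a\<close>, \<open>b\<close> of
  components of the first three kinds and on whether a larger star exists. The weight
  \<open>4i + 2a + 3b\<close> estimates five times the remaining length. Compared with it, a move gains \<open>2\<close> by
  extending a single edge or closing a triangle, gains \<open>1\<close> by enlarging a star, and loses \<open>1\<close> by
  joining two isolated vertices or \<open>2\<close> by turning a path into a star. Shortener destroys any path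
  at once and otherwise joins isolated vertices. Prolonger extends a single edge if possible, else
  closes a triangle, else enlarges a star, so that a loss caused by Shortener is made up for.\<close>

section \<open>Effect of a move on the component counts\<close>

definition nbrs :: "'a set set \<Rightarrow> 'a \<Rightarrow> 'a set" where
  "nbrs X v = {w. {v, w} \<in> X}"

text \<open>The vertices \<open>w\<close>, \<open>x\<close>, \<open>y\<close>, \<open>z\<close> run
  along a walk. Three inequalities suffice, since consecutive vertices differ once edges are
  two-element sets.\<close>

definition P4_free :: "'a set set \<Rightarrow> bool" where
  "P4_free X \<longleftrightarrow> (\<forall>w x y z. w \<in> nbrs X x \<and> y \<in> nbrs X x \<and> z \<in> nbrs X y \<longrightarrow>
     w = y \<or> x = z \<or> w = z)"

definition isolated :: "'a set \<Rightarrow> 'a set set \<Rightarrow> 'a set" where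
  "isolated V X = {v \<in> V. nbrs X v = {}}"

definition lone_edge :: "'a set set \<Rightarrow> 'a \<Rightarrow> 'a \<Rightarrow> bool" where
  "lone_edge X u v \<longleftrightarrow> nbrs X u = {v} \<and> nbrs X v = {u}"

text \<open>Unordered pairs, because \<open>lone_edge\<close> is symmetric and each such edge should
  count once.\<close>

definition lone_edges :: "'a set set \<Rightarrow> 'a set set" where
  "lone_edges X = {{u, v} | u v. lone_edge X u v}"

text \<open>A cherry is a component that is a path on three vertices; it is counted by its centre.\<close>

definition cherry :: "'a set set \<Rightarrow> 'a \<Rightarrow> 'a \<Rightarrow> 'a \<Rightarrow> bool" where
  "cherry X c u w \<longleftrightarrow> u \<noteq> w \<and> nbrs X c = {u, w} \<and> nbrs X u = {c} \<and> nbrs X w = {c}"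

definition cherries :: "'a set set \<Rightarrow> 'a set" where
  "cherries X = {c. \<exists>u w. cherry X c u w}"

definition has_big_star :: "'a set set \<Rightarrow> bool" where
  "has_big_star X \<longleftrightarrow> (\<exists>c. card (nbrs X c) \<ge> 3)"

definition counts :: "'a set \<Rightarrow> 'a set set \<Rightarrow> nat \<times> nat \<times> nat \<times> bool" where
  "counts V X =
     (card (isolated V X), card (lone_edges X), card (cherries X), has_big_star X)"

text \<open>The game on the counts. An isolated vertex can only be joined to another one, to an end
  of a single edge, or to the centre of a cherry or larger star; otherwise only the two ends of a
  cherry can be joined. Everything else creates a path on four vertices.\<close>

inductive step :: "nat \<times> nat \<times> nat \<times> bool \<Rightarrow> nat \<times> nat \<times> nat \<times> bool \<Rightarrow> bool" where
  new_edge: "step (Suc (Suc i), a, b, s) (i, Suc a, b, s)"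
| new_cherry: "step (Suc i, Suc a, b, s) (i, a, Suc b, s)"
| new_star: "step (Suc i, a, Suc b, s) (i, a, b, True)"
| new_triangle: "step (i, a, Suc b, s) (i, a, b, s)"
| grow_star: "step (Suc i, a, b, True) (i, a, b, True)"

lemma nbrs_sym: "w \<in> nbrs X v \<longleftrightarrow> v \<in> nbrs X w"
  by (simp add: nbrs_def insert_commute)

lemma nbrs_insert:
  assumes "u \<noteq> v"
  shows "nbrs (insert {u, v} X) x =
    (if x = u then insert v (nbrs X u) else if x = v then insert u (nbrs X v) else nbrs X x)"
  using assms by (auto simp: nbrs_def doubleton_eq_iff)

locale P4_free_graph =
  fixes V :: "'a set" and X :: "'a set set"
  assumes finite_V: "finite V"
    and edges_in: "X \<subseteq> [V]\<^bsup>2\<^esup>"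
    and P4_free: "P4_free X"
begin

section \<open>Elementary facts on finite graphs without a path on four vertices\<close>

lemma nbrs_in: "w \<in> nbrs X v \<Longrightarrow> v \<in> V \<and> w \<in> V \<and> v \<noteq> w"
  using edges_in by (force simp: nbrs_def nsets_def)

lemma irrefl: "v \<notin> nbrs X v"
  using nbrs_in by blast

lemma finite_nbrs: "finite (nbrs X v)"
  by (rule finite_subset[OF _ finite_V]) (use nbrs_in in blast)

lemma finite_isolated: "finite (isolated V X)"
  using finite_V by (simp add: isolated_def)

lemma finite_lone_edges: "finite (lone_edges X)"
proof (rule finite_subset)
  show "lone_edges X \<subseteq> Pow V"
    unfolding lone_edges_def lone_edge_def using nbrs_in by blast
qed (use finite_V in simp)

lemma finite_cherries: "finite (cherries X)"
  by (rule finite_subset[OF _ finite_V]) (use nbrs_in in \<open>unfold cherries_def cherry_def, blast\<close>)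

lemma P4D: "w \<in> nbrs X x \<Longrightarrow> y \<in> nbrs X x \<Longrightarrow> z \<in> nbrs X y \<Longrightarrow> w = y \<or> x = z \<or> w = z"
  using P4_free unfolding P4_free_def by blast

lemma has_big_star_insert:
  assumes "u \<noteq> v" "has_big_star X"
  shows "has_big_star (insert {u, v} X)"
proof -
  obtain c where "card (nbrs X c) \<ge> 3" using assms by (auto simp: has_big_star_def)
  moreover have "card (nbrs X c) \<le> card (nbrs (insert {u, v} X) c)"
    by (rule card_mono) (use assms finite_nbrs in \<open>auto simp: nbrs_insert\<close>)
  ultimately show ?thesis unfolding has_big_star_def by (meson le_trans)
qed

section \<open>Legality and effect of each kind of move\<close>

text \<open>This and the other \<open>counts_new_\<close> and \<open>counts_grow_\<close> lemmas
  treat one rule of \<open>step\<close> each. The counts are given in the \<open>Suc\<close>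
  patterns of the rule, so that the lemmas serve both directions of the correspondence between moves
  and steps.\<close>

lemma counts_new_edge:
  assumes uv: "u \<noteq> v" "u \<in> V" "v \<in> V" and u: "nbrs X u = {}" and v: "nbrs X v = {}"
  shows "P4_free (insert {u, v} X)"
    and "\<exists>i a b s. counts V X = (Suc (Suc i), a, b, s) \<and> counts V (insert {u, v} X) = (i, Suc a, b, s)"
proof -
  let ?X = "insert {u, v} X"
  have not_nbr: "u \<notin> nbrs X x" "v \<notin> nbrs X x" for x
    using u v nbrs_sym by (metis empty_iff)+
  show "P4_free ?X"
    using P4_free not_nbr u v uv unfolding P4_free_def by (auto simp: nbrs_insert split: if_splits)
  have "isolated V X = insert u (insert v (isolated V ?X))" "u \<notin> isolated V ?X" "v \<notin> isolated V ?X"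
    using u v uv by (auto simp: isolated_def nbrs_insert)
  moreover have "finite (isolated V ?X)" using finite_V by (simp add: isolated_def)
  ultimately have 1: "card (isolated V X) = Suc (Suc (card (isolated V ?X)))"
    using uv by simp
  have "lone_edge ?X x y \<longleftrightarrow> lone_edge X x y \<or> (x = u \<and> y = v) \<or> (x = v \<and> y = u)" for x y
    using not_nbr u v uv by (auto simp: lone_edge_def nbrs_insert)
  then have lone: "lone_edges ?X = insert {u, v} (lone_edges X)"
    unfolding lone_edges_def by blast
  have "{u, v} \<notin> lone_edges X"
    using u v by (auto simp: lone_edges_def lone_edge_def doubleton_eq_iff)
  then have 2: "card (lone_edges ?X) = Suc (card (lone_edges X))"
    using lone finite_lone_edges by simp
  have "cherry ?X c x y = cherry X c x y" for c x y
    using not_nbr u v uv by (auto simp: cherry_def nbrs_insert)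
  then have 3: "cherries ?X = cherries X"
    by (simp add: cherries_def)
  have 4: "has_big_star ?X = has_big_star X"
  proof
    assume "has_big_star ?X"
    then obtain c where "card (nbrs ?X c) \<ge> 3" by (auto simp: has_big_star_def)
    then show "has_big_star X" using u v uv unfolding has_big_star_def
      by (intro exI[of _ c]) (auto simp: nbrs_insert split: if_splits)
  qed (use has_big_star_insert uv in simp)
  show "\<exists>i a b s. counts V X = (Suc (Suc i), a, b, s) \<and> counts V ?X = (i, Suc a, b, s)"
    unfolding counts_def 1 2 3 4 by simp
qed

text \<open>A new path on four vertices would end in \<open>u\<close> and so run \<open>u\<close>,
  \<open>v\<close>, \<open>w\<close>; it cannot go on, because \<open>w\<close> is a leaf at
  \<open>v\<close>. This covers \<open>v\<close> as an end of a single edge and as the centre of a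
  cherry or of a larger star.\<close>

lemma pendant_edge:
  assumes uv: "u \<noteq> v" "u \<in> V" "v \<in> V" and u: "nbrs X u = {}" and v: "nbrs X v \<noteq> {}"
    and leaves: "\<And>w. w \<in> nbrs X v \<Longrightarrow> nbrs X w = {v}"
  shows "P4_free (insert {u, v} X)"
    and "card (isolated V X) = Suc (card (isolated V (insert {u, v} X)))"
proof -
  let ?X = "insert {u, v} X"
  have not_nbr: "u \<notin> nbrs X x" for x
    using u nbrs_sym by (metis empty_iff)
  have leafD: "b = v" if "a \<in> nbrs X v" "b \<in> nbrs X a" for a b
    using leaves that by blast
  have leafD': "b = v" if "v \<in> nbrs X a" "b \<in> nbrs X a" for a b
    using leafD[of a b] that nbrs_sym[of v X a] by simp
  show "P4_free ?X"
    unfolding P4_free_def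
  proof (intro allI impI, elim conjE)
    fix w x y z
    assume *: "w \<in> nbrs ?X x" "y \<in> nbrs ?X x" "z \<in> nbrs ?X y"
    consider "x = u" | "x = v" | "x \<noteq> u" "x \<noteq> v" by blast
    then show "w = y \<or> x = z \<or> w = z"
    proof cases
      case 1
      then show ?thesis using * uv u by (simp add: nbrs_insert)
    next
      case 2
      then show ?thesis using * uv u not_nbr leafD by (auto simp: nbrs_insert split: if_splits)
    next
      case 3
      then have "w \<in> nbrs X x" "y \<in> nbrs X x" using * uv by (auto simp: nbrs_insert)
      \<comment> \<open>Of the neighbourhoods involved only that of \<open>y\<close> can have grown,
        namely if \<open>y = v\<close>. Then \<open>x\<close> is a leaf at \<open>v\<close>, which
        forces \<open>w = v\<close>.\<close>
      then show ?thesis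
        using P4D[of w x y z] leafD'[of x w] * uv not_nbr
        by (cases "y = v") (auto simp: nbrs_insert split: if_splits)
    qed
  qed
  have "isolated V X = insert u (isolated V ?X)" "u \<notin> isolated V ?X"
    using u uv v by (auto simp: isolated_def nbrs_insert)
  moreover have "finite (isolated V ?X)" using finite_V by (simp add: isolated_def)
  ultimately show "card (isolated V X) = Suc (card (isolated V ?X))"
    by simp
qed

lemma counts_new_cherry:
  assumes uv: "u \<noteq> v" "u \<in> V" and u: "nbrs X u = {}" and vw: "lone_edge X v w"
  shows "P4_free (insert {u, v} X)"
    and "\<exists>i a b s. counts V X = (Suc i, Suc a, b, s) \<and> counts V (insert {u, v} X) = (i, a, Suc b, s)"
proof -
  let ?X = "insert {u, v} X"
  have v: "nbrs X v = {w}" and w: "nbrs X w = {v}" using vw by (auto simp: lone_edge_def)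
  have [simp]: "v \<in> V" "v \<noteq> w" "w \<noteq> v" "u \<noteq> w" "w \<noteq> u" using nbrs_in[of w v] v w u by auto
  have not_nbr: "u \<notin> nbrs X x" for x
    using u nbrs_sym by (metis empty_iff)
  have v_nbr: "v \<in> nbrs X x \<longleftrightarrow> x = w" for x
    using nbrs_sym v by (metis singleton_iff)
  have w_nbr: "w \<in> nbrs X x \<longleftrightarrow> x = v" for x
    using nbrs_sym w by (metis singleton_iff)
  show "P4_free ?X"
    by (rule pendant_edge) (use uv u v w in auto)
  have 1: "card (isolated V X) = Suc (card (isolated V ?X))"
    by (rule pendant_edge) (use uv u v w in auto)
  have "lone_edge ?X x y \<longleftrightarrow> lone_edge X x y \<and> {x, y} \<noteq> {v, w}" for x y
    using not_nbr u v uv w v_nbr w_nbr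
    by (auto simp: lone_edge_def nbrs_insert doubleton_eq_iff split: if_splits)
  then have "lone_edges X = insert {v, w} (lone_edges ?X)" "{v, w} \<notin> lone_edges ?X"
    using vw unfolding lone_edges_def by blast+
  then have 2: "card (lone_edges X) = Suc (card (lone_edges ?X))"
    using finite_lone_edges by simp
  have "cherry ?X c x y \<longleftrightarrow> cherry X c x y \<or> c = v \<and> (x = u \<and> y = w \<or> x = w \<and> y = u)" for c x y
    using not_nbr u v uv w v_nbr w_nbr
    by (auto simp: cherry_def nbrs_insert doubleton_eq_iff insert_commute)
  then have cherries: "cherries ?X = insert v (cherries X)"
    unfolding cherries_def by blast
  have "v \<notin> cherries X"
    using v by (auto simp: cherries_def cherry_def)
  then have 3: "card (cherries ?X) = Suc (card (cherries X))"
    using cherries finite_cherries by simp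
  have 4: "has_big_star ?X = has_big_star X"
  proof
    assume "has_big_star ?X"
    then obtain c where "card (nbrs ?X c) \<ge> 3" by (auto simp: has_big_star_def)
    then show "has_big_star X" using u v uv unfolding has_big_star_def
      by (intro exI[of _ c]) (auto simp: nbrs_insert split: if_splits)
  qed (use has_big_star_insert uv in simp)
  show "\<exists>i a b s. counts V X = (Suc i, Suc a, b, s) \<and> counts V ?X = (i, a, Suc b, s)"
    unfolding counts_def 1 2 3 4 by simp
qed

lemma counts_new_star:
  assumes uv: "u \<noteq> v" "u \<in> V" and u: "nbrs X u = {}" and vw: "cherry X v w1 w2"
  shows "P4_free (insert {u, v} X)"
    and "\<exists>i a b s. counts V X = (Suc i, a, Suc b, s) \<and> counts V (insert {u, v} X) = (i, a, b, True)"
proof -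
  let ?X = "insert {u, v} X"
  have v: "nbrs X v = {w1, w2}" and w: "nbrs X w1 = {v}" "nbrs X w2 = {v}" "w1 \<noteq> w2"
    using vw by (auto simp: cherry_def)
  have [simp]: "v \<in> V" "v \<noteq> w1" "w1 \<noteq> v" "u \<noteq> w1" "w1 \<noteq> u" "v \<noteq> w2" "w2 \<noteq> v" "u \<noteq> w2" "w2 \<noteq> u"
    using nbrs_in[of w1 v] nbrs_in[of w2 v] v w u by auto
  have not_nbr: "u \<notin> nbrs X x" for x
    using u nbrs_sym by (metis empty_iff)
  have v_nbr: "v \<in> nbrs X x \<longleftrightarrow> x = w1 \<or> x = w2" for x
    using nbrs_sym v by (metis insert_iff singleton_iff)
  have w_nbr: "w1 \<in> nbrs X x \<longleftrightarrow> x = v" "w2 \<in> nbrs X x \<longleftrightarrow> x = v" for x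
    using nbrs_sym w by (metis singleton_iff)+
  show "P4_free ?X"
    by (rule pendant_edge) (use uv u v w in auto)
  have 1: "card (isolated V X) = Suc (card (isolated V ?X))"
    by (rule pendant_edge) (use uv u v w in auto)
  have "lone_edge ?X x y \<longleftrightarrow> lone_edge X x y" for x y
    using not_nbr u v uv w v_nbr w_nbr
    by (auto simp: lone_edge_def nbrs_insert doubleton_eq_iff split: if_splits)
  then have 2: "lone_edges ?X = lone_edges X"
    unfolding lone_edges_def by blast
  have star: "nbrs ?X v = {u, w1, w2}"
    using uv v by (simp add: nbrs_insert)
  \<comment> \<open>The centre \<open>v\<close> now has three neighbours, so it no longer counts as
    the centre of a cherry.\<close>
  have "card {u, w1, w2} \<noteq> card {x, y}" for x y
    using w(3) by (simp add: card_insert_if)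
  then have "{u, w1, w2} \<noteq> {x, y}" for x y by metis
  then have "cherry ?X c x y \<longleftrightarrow> cherry X c x y \<and> c \<noteq> v" for c x y
    using not_nbr u v uv w v_nbr w_nbr
    by (auto simp: cherry_def nbrs_insert doubleton_eq_iff split: if_splits)
  then have "cherries X = insert v (cherries ?X)" "v \<notin> cherries ?X"
    using vw unfolding cherries_def by blast+
  then have 3: "card (cherries X) = Suc (card (cherries ?X))"
    using finite_cherries by simp
  have 4: "has_big_star ?X = True"
    unfolding has_big_star_def using star w(3) by (auto intro!: exI[of _ v])
  show "\<exists>i a b s. counts V X = (Suc i, a, Suc b, s) \<and> counts V ?X = (i, a, b, True)"
    unfolding counts_def 1 2 3 4 by simp
qed

text \<open>A vertex of degree at least 3 is the centre of a star component: if a neighbour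
  \<open>w\<close> had another neighbour \<open>z\<close>, some third neighbour \<open>y\<close> of
  \<open>v\<close> would give the path \<open>y\<close>, \<open>v\<close>, \<open>w\<close>,
  \<open>z\<close>.\<close>

lemma counts_grow_star:
  assumes uv: "u \<noteq> v" "u \<in> V" and u: "nbrs X u = {}" and v: "card (nbrs X v) \<ge> 3"
  shows "P4_free (insert {u, v} X)"
    and "\<exists>i a b. counts V X = (Suc i, a, b, True) \<and> counts V (insert {u, v} X) = (i, a, b, True)"
proof -
  let ?X = "insert {u, v} X"
  have ne: "nbrs X v \<noteq> {}" using v by auto
  then have [simp]: "v \<in> V" using nbrs_in by blast
  have leaves: "nbrs X w = {v}" if w: "w \<in> nbrs X v" for w
  proof (rule ccontr)
    assume "nbrs X w \<noteq> {v}"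
    moreover have "v \<in> nbrs X w" using w nbrs_sym by metis
    ultimately obtain z where z: "z \<in> nbrs X w" "z \<noteq> v" by blast
    have "card {w, z} < card (nbrs X v)"
      using v card_insert_le_m1[of 2 "{z}" w] by simp
    then obtain y where "y \<in> nbrs X v" "y \<noteq> w" "y \<noteq> z"
      by (metis card_mono finite.emptyI finite.insertI insertCI linorder_not_le subsetI)
    then show False using P4D[of y v w z] w z by blast
  qed
  have not_nbr: "u \<notin> nbrs X x" for x
    using u nbrs_sym by (metis empty_iff)
  \<comment> \<open>Both before and after the move \<open>v\<close> has too many neighbours to
    belong to a single edge or a cherry, so these counts do not change.\<close>
  have card1: "nbrs X v \<noteq> {x}" and card2: "nbrs X v \<noteq> {x, y}"
    and card1': "insert u (nbrs X v) \<noteq> {x}" and card2': "insert u (nbrs X v) \<noteq> {x, y}" for x y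
  proof -
    have *: "A \<noteq> {x, y}" if "card A \<ge> 3" for A and x y :: 'a
      using that by (auto simp: card_insert_if split: if_splits)
    have "card (insert u (nbrs X v)) \<ge> 3"
      using v not_nbr finite_nbrs by simp
    then show "nbrs X v \<noteq> {x, y}" "insert u (nbrs X v) \<noteq> {x, y}"
      "nbrs X v \<noteq> {x}" "insert u (nbrs X v) \<noteq> {x}"
      using v *[of _ x y] *[of _ x x] by auto
  qed
  show "P4_free ?X"
    by (rule pendant_edge) (use uv u ne leaves in auto)
  have 1: "card (isolated V X) = Suc (card (isolated V ?X))"
    by (rule pendant_edge) (use uv u ne leaves in auto)
  have "lone_edge ?X x y \<longleftrightarrow> lone_edge X x y" for x y
    using not_nbr u uv card1 card1' by (auto simp: lone_edge_def nbrs_insert)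
  then have 2: "lone_edges ?X = lone_edges X"
    unfolding lone_edges_def by blast
  have "cherry ?X c x y \<longleftrightarrow> cherry X c x y" for c x y
    using not_nbr u uv card1 card1' card2 card2' by (auto simp: cherry_def nbrs_insert)
  then have 3: "cherries ?X = cherries X"
    unfolding cherries_def by blast
  have star: "has_big_star X = True"
    using v by (auto simp: has_big_star_def)
  then have star': "has_big_star ?X = True"
    using has_big_star_insert uv by simp
  show "\<exists>i a b. counts V X = (Suc i, a, b, True) \<and> counts V ?X = (i, a, b, True)"
    unfolding counts_def 1 2 3 star star' by simp
qed

text \<open>The component has only three vertices, too few for the forbidden path, and its degrees
  stay at most 2, so no large star appears.\<close>

lemma counts_new_triangle:
  assumes w: "cherry X w u v"
  shows "P4_free (insert {u, v} X)"
    and "\<exists>i a b s. counts V X = (i, a, Suc b, s) \<and> counts V (insert {u, v} X) = (i, a, b, s)"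
proof -
  let ?X = "insert {u, v} X"
  have nbrs: "nbrs X w = {u, v}" "nbrs X u = {w}" "nbrs X v = {w}" and uv: "u \<noteq> v"
    using w by (auto simp: cherry_def)
  have [simp]: "v \<in> V" "u \<in> V" "v \<noteq> w" "w \<noteq> v" "u \<noteq> w" "w \<noteq> u"
    using nbrs_in[of u w] nbrs_in[of v w] nbrs by auto
  have u_nbr: "u \<in> nbrs X x \<longleftrightarrow> x = w" and v_nbr: "v \<in> nbrs X x \<longleftrightarrow> x = w"
    and w_nbr: "w \<in> nbrs X x \<longleftrightarrow> x = u \<or> x = v" for x
    using nbrs_sym nbrs by (metis insert_iff singleton_iff)+
  show "P4_free ?X"
    unfolding P4_free_def
  proof (intro allI impI, elim conjE)
    fix a b c d
    assume *: "a \<in> nbrs ?X b" "c \<in> nbrs ?X b" "d \<in> nbrs ?X c"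
    show "a = c \<or> b = d \<or> a = d"
      using * P4D[of a b c d] uv nbrs u_nbr v_nbr w_nbr
      by (auto simp: nbrs_insert split: if_splits)
  qed
  have 1: "isolated V ?X = isolated V X"
    using uv nbrs by (auto simp: isolated_def nbrs_insert)
  have "lone_edge ?X x y \<longleftrightarrow> lone_edge X x y" for x y
    using nbrs uv u_nbr v_nbr w_nbr
    by (auto simp: lone_edge_def nbrs_insert doubleton_eq_iff split: if_splits)
  then have 2: "lone_edges ?X = lone_edges X"
    unfolding lone_edges_def by blast
  have "cherry ?X c x y \<longleftrightarrow> cherry X c x y \<and> c \<noteq> w" for c x y
    using nbrs uv u_nbr v_nbr w_nbr
    by (auto simp: cherry_def nbrs_insert doubleton_eq_iff split: if_splits)
  then have "cherries X = insert w (cherries ?X)" "w \<notin> cherries ?X"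
    using w unfolding cherries_def by blast+
  then have 3: "card (cherries X) = Suc (card (cherries ?X))"
    using finite_cherries by simp
  have 4: "has_big_star ?X = has_big_star X"
  proof
    assume "has_big_star ?X"
    then obtain c where "card (nbrs ?X c) \<ge> 3" by (auto simp: has_big_star_def)
    then show "has_big_star X" using nbrs uv unfolding has_big_star_def
      by (intro exI[of _ c]) (auto simp: nbrs_insert split: if_splits)
  qed (use has_big_star_insert uv in simp)
  show "\<exists>i a b s. counts V X = (i, a, Suc b, s) \<and> counts V ?X = (i, a, b, s)"
    unfolding counts_def 1 2 3 4 by simp
qed

section \<open>Correspondence between legal moves and steps\<close>

text \<open>Since \<open>u\<close>, \<open>v\<close>, \<open>w\<close>, \<open>z\<close> must not
  become a path, all neighbours of \<open>v\<close> are leaves. The degree of \<open>v\<close> then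
  decides which rule applies.\<close>

lemma step_insert_isolated:
  assumes uv: "u \<noteq> v" "u \<in> V" "v \<in> V" and u: "nbrs X u = {}" and free: "P4_free (insert {u, v} X)"
  shows "step (counts V X) (counts V (insert {u, v} X))"
proof -
  have leaves: "nbrs X w = {v}" if w: "w \<in> nbrs X v" for w
  proof (rule ccontr)
    assume "nbrs X w \<noteq> {v}"
    moreover have vw: "v \<in> nbrs X w" using w nbrs_sym by metis
    ultimately obtain z where z: "z \<in> nbrs X w" "z \<noteq> v" by blast
    have "z \<noteq> u" "w \<noteq> u" using z u w nbrs_sym by (metis empty_iff)+
    moreover have "w \<noteq> v" using w irrefl by blast
    ultimately show False
      using free[unfolded P4_free_def, rule_format, of u v w z] w z uv
      by (simp add: nbrs_insert)
  qed
  consider "card (nbrs X v) = 0" | "card (nbrs X v) = 1" | "card (nbrs X v) = 2" | "card (nbrs X v) \<ge> 3"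
    by linarith
  then show ?thesis
  proof cases
    case 1
    then show ?thesis
      using counts_new_edge(2)[of u v] uv u finite_nbrs by (auto intro: step.intros)
  next
    case 2
    then obtain w where "nbrs X v = {w}" by (auto simp: card_1_singleton_iff)
    then have "lone_edge X v w" using leaves by (simp add: lone_edge_def)
    then show ?thesis
      using counts_new_cherry(2)[of u v w] uv u by (auto intro: step.intros)
  next
    case 3
    then obtain w1 w2 where "nbrs X v = {w1, w2}" "w1 \<noteq> w2" by (auto simp: card_2_iff)
    then have "cherry X v w1 w2" using leaves by (simp add: cherry_def)
    then show ?thesis
      using counts_new_star(2)[of u v w1 w2] uv u by (auto intro: step.intros)
  next
    case 4
    then show ?thesis
      using counts_grow_star(2)[of u v] uv u by (auto intro: step.intros)
  qed
qed

text \<open>If neither end is isolated, the new edge lies in the middle of a path unless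
  \<open>u\<close> and \<open>v\<close> have one and the same single neighbour \<open>w\<close>. A
  further neighbour \<open>z\<close> of \<open>w\<close> would give the path \<open>v\<close>,
  \<open>u\<close>, \<open>w\<close>, \<open>z\<close>, so the move closes a cherry to a
  triangle.\<close>

lemma step_insert:
  assumes uv: "{u, v} \<in> [V]\<^bsup>2\<^esup>" "{u, v} \<notin> X" and free: "P4_free (insert {u, v} X)"
  shows "step (counts V X) (counts V (insert {u, v} X))"
proof -
  have neq: "u \<noteq> v" "u \<in> V" "v \<in> V"
    using uv by (auto simp: nsets_def card_insert_if split: if_splits)
  consider "nbrs X u = {}" | "nbrs X v = {}" | "nbrs X u \<noteq> {}" "nbrs X v \<noteq> {}" by blast
  then show ?thesis
  proof cases
    case 1
    then show ?thesis using step_insert_isolated neq free by blast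
  next
    case 2
    then show ?thesis
      using step_insert_isolated[of v u] neq free by (simp add: insert_commute)
  next
    case 3
    have uv': "v \<notin> nbrs X u" "u \<notin> nbrs X v"
      using uv by (auto simp: nbrs_def insert_commute)
    have common: "x = y" if "x \<in> nbrs X u" "y \<in> nbrs X v" for x y
      using free[unfolded P4_free_def, rule_format, of x u v y] that neq uv'
      by (auto simp: nbrs_insert)
    then obtain w where u: "nbrs X u = {w}" and v: "nbrs X v = {w}" using 3 by blast
    have w: "w \<noteq> u" "w \<noteq> v" using u v irrefl by blast+
    have "z = u \<or> z = v" if z: "z \<in> nbrs X w" for z
      using free[unfolded P4_free_def, rule_format, of v u w z] z neq u v w
      by (auto simp: nbrs_insert)
    moreover have "u \<in> nbrs X w" "v \<in> nbrs X w" using u v nbrs_sym by (metis singleton_iff)+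
    ultimately have "nbrs X w = {u, v}" by blast
    then have "cherry X w u v" using u v neq by (simp add: cherry_def)
    then show ?thesis using counts_new_triangle(2)[of w u v] by (auto intro: step.intros)
  qed
qed

text \<open>Converse of \<open>step_insert\<close>: every step can be played on the actual graph, so
  strategies may be described by the counts alone.\<close>

lemma step_move_exists:
  assumes "step (counts V X) c"
  shows "\<exists>e \<in> [V]\<^bsup>2\<^esup> - X. P4_free (insert e X) \<and> counts V (insert e X) = c"
proof -
  have isol: "{u, v} \<in> [V]\<^bsup>2\<^esup> - X" if "u \<noteq> v" "u \<in> V" "v \<in> V" "v \<notin> nbrs X u" for u v
    using that by (auto simp: nsets_def nbrs_def)
  have get_isolated: "\<exists>u \<in> V. nbrs X u = {}" if "card (isolated V X) = Suc i" for i
  proof -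
    have "isolated V X \<noteq> {}" using that by auto
    then show ?thesis by (auto simp: isolated_def)
  qed
  show ?thesis
    using assms
  proof (cases rule: step.cases)
    case (new_edge i a b s)
    then have "card (isolated V X) \<ge> 2" by (simp add: counts_def)
    then obtain u v where "u \<in> isolated V X" "v \<in> isolated V X" "u \<noteq> v"
      using card_le_Suc0_iff_eq[OF finite_isolated] by force
    then have uv: "u \<noteq> v" "u \<in> V" "v \<in> V" "nbrs X u = {}" "nbrs X v = {}"
      by (auto simp: isolated_def)
    show ?thesis
      using counts_new_edge[OF uv] new_edge uv
      by (intro bexI[of _ "{u, v}"] isol) auto
  next
    case (new_cherry i a b s)
    then obtain u where u: "u \<in> V" "nbrs X u = {}" using get_isolated by (auto simp: counts_def)
    have "lone_edges X \<noteq> {}" using new_cherry by (auto simp: counts_def)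
    then obtain v w where vw: "lone_edge X v w" by (auto simp: lone_edges_def)
    then have "v \<in> V" "u \<noteq> v" using nbrs_in[of w v] u by (auto simp: lone_edge_def)
    then show ?thesis
      using counts_new_cherry[OF _ u vw] new_cherry u
      by (intro bexI[of _ "{u, v}"] isol) auto
  next
    case (new_star i a b s)
    then obtain u where u: "u \<in> V" "nbrs X u = {}" using get_isolated by (auto simp: counts_def)
    have "cherries X \<noteq> {}" using new_star by (auto simp: counts_def)
    then obtain v w1 w2 where vw: "cherry X v w1 w2" by (auto simp: cherries_def)
    then have "v \<in> V" "u \<noteq> v" using nbrs_in[of w1 v] u by (auto simp: cherry_def)
    then show ?thesis
      using counts_new_star[OF _ u vw] new_star u
      by (intro bexI[of _ "{u, v}"] isol) auto
  next
    case (new_triangle i a b s)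
    have "cherries X \<noteq> {}" using new_triangle by (auto simp: counts_def)
    then obtain w u v where w: "cherry X w u v" by (auto simp: cherries_def)
    then have "v \<in> V" "u \<in> V" "u \<noteq> v" "v \<notin> nbrs X u"
      using nbrs_in[of u w] nbrs_in[of v w] by (auto simp: cherry_def)
    then show ?thesis
      using counts_new_triangle[OF w] new_triangle
      by (intro bexI[of _ "{u, v}"] isol) auto
  next
    case (grow_star i a b)
    then obtain u where u: "u \<in> V" "nbrs X u = {}" using get_isolated by (auto simp: counts_def)
    obtain v where v: "card (nbrs X v) \<ge> 3"
      using grow_star by (auto simp: counts_def has_big_star_def)
    then have "nbrs X v \<noteq> {}" by auto
    then have "v \<in> V" "u \<noteq> v" using nbrs_in u by blast+
    then show ?thesis
      using counts_grow_star[OF _ u v] grow_star u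
      by (intro bexI[of _ "{u, v}"] isol) auto
  qed
qed

end

section \<open>Optimal play\<close>

text \<open>An embedding of the path is a walk with distinct vertices. Edges are two-element sets,
  so injectivity reduces to the three inequalities in \<open>P4_free\<close>.\<close>

lemma family_free_iff_P4_free:
  assumes X: "X \<subseteq> [{..<n}]\<^bsup>2\<^esup>"
  shows "family_free {path_graph 4} (position (complete_graph n) X) \<longleftrightarrow> P4_free X"
proof -
  have path: "edges (path_graph 4) = {{0, 1}, {1, 2}, {2, 3}}"
  proof -
    have "Suc i < 4 \<longleftrightarrow> i = 0 \<or> i = 1 \<or> i = 2" for i by auto
    then show ?thesis by (auto simp: path_graph_def numeral_3_eq_3 numeral_2_eq_2)
  qed
  have verts: "verts (path_graph 4) = {0, 1, 2, 3}"
    by (auto simp: path_graph_def)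
  have contains: "contains (position (complete_graph n) X) (path_graph 4) \<longleftrightarrow>
    (\<exists>f :: nat \<Rightarrow> nat. inj_on f {0, 1, 2, 3} \<and> f ` {0, 1, 2, 3} \<subseteq> {..<n} \<and>
      {f 0, f 1} \<in> X \<and> {f 1, f 2} \<in> X \<and> {f 2, f 3} \<in> X)"
    unfolding contains_def path verts by (simp add: position_def complete_graph_def)
  have in_V: "u < n \<and> v < n \<and> u \<noteq> v" if "{u, v} \<in> X" for u v
    using that X by (force simp: nsets_def)
  show ?thesis
  proof
    assume free: "family_free {path_graph 4} (position (complete_graph n) X)"
    show "P4_free X"
      unfolding P4_free_def
    proof (intro allI impI, elim conjE, rule ccontr)
      fix w x y z
      assume "w \<in> nbrs X x" "y \<in> nbrs X x" "z \<in> nbrs X y" and neq: "\<not> (w = y \<or> x = z \<or> w = z)"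
      then have e: "{w, x} \<in> X" "{x, y} \<in> X" "{y, z} \<in> X"
        by (auto simp: nbrs_def insert_commute)
      let ?f = "\<lambda>k. [w, x, y, z] ! k"
      have "contains (position (complete_graph n) X) (path_graph 4)"
        unfolding contains
        by (rule exI[of _ ?f]) (use e neq in_V in \<open>auto simp: numeral_3_eq_3 numeral_2_eq_2\<close>)
      then show False using free by (simp add: family_free_def)
    qed
  next
    assume free: "P4_free X"
    show "family_free {path_graph 4} (position (complete_graph n) X)"
    proof (rule ccontr)
      assume "\<not> ?thesis"
      then obtain f where f: "inj_on f {0, 1, 2, 3::nat}"
          "{f 0, f 1} \<in> X" "{f 1, f 2} \<in> X" "{f 2, f 3} \<in> X"
        by (auto simp: family_free_def contains)
      then have "f 0 \<in> nbrs X (f 1)" "f 2 \<in> nbrs X (f 1)" "f 3 \<in> nbrs X (f 2)"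
        by (auto simp: nbrs_def insert_commute)
      then have "f 0 = f 2 \<or> f 1 = f 3 \<or> f 0 = f 3"
        using free unfolding P4_free_def by blast
      then show False using f(1) by (auto simp: inj_on_def)
    qed
  qed
qed

abbreviation P4_value :: "nat \<Rightarrow> player \<Rightarrow> nat set set \<Rightarrow> nat" where
  "P4_value n \<equiv> remaining_length {path_graph 4} (complete_graph n)"

abbreviation P4_moves :: "nat \<Rightarrow> nat set set \<Rightarrow> nat set set" where
  "P4_moves n \<equiv> moves {path_graph 4} (complete_graph n)"

fun opponent :: "player \<Rightarrow> player" where
  "opponent Prolonger = Shortener"
| "opponent Shortener = Prolonger"

locale P4_position = P4_free_graph "{..<n}" X for n :: nat and X
begin

lemma moves_eq: "P4_moves n X = {e \<in> [{..<n}]\<^bsup>2\<^esup> - X. P4_free (insert e X)}"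
  using edges_in family_free_iff_P4_free[of "insert _ X" n]
  by (auto simp: moves_def complete_graph_def)

lemma finite_moves: "finite (P4_moves n X)"
  unfolding moves_eq by (simp add: finite_imp_finite_nsets)

lemma position_insert:
  assumes "e \<in> P4_moves n X"
  shows "P4_position n (insert e X)" "step (counts {..<n} X) (counts {..<n} (insert e X))"
proof -
  show "P4_position n (insert e X)"
    using assms edges_in by unfold_locales (auto simp: moves_eq)
  have e: "e \<in> [{..<n}]\<^bsup>2\<^esup>" "e \<notin> X" "P4_free (insert e X)"
    using assms by (auto simp: moves_eq)
  then obtain u v where "e = {u, v}" by (auto simp: nsets_def card_2_iff)
  then show "step (counts {..<n} X) (counts {..<n} (insert e X))"
    using step_insert e by blast
qed

lemma obtain_move:
  assumes "step (counts {..<n} X) c"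
  obtains e where "e \<in> P4_moves n X" "counts {..<n} (insert e X) = c"
  using step_move_exists[OF assms] by (auto simp: moves_eq)

lemma value_eq:
  "P4_value n Prolonger X = (if P4_moves n X = {} then 0
     else 1 + Max ((\<lambda>e. P4_value n Shortener (insert e X)) ` P4_moves n X))"
  "P4_value n Shortener X = (if P4_moves n X = {} then 0
     else 1 + Min ((\<lambda>e. P4_value n Prolonger (insert e X)) ` P4_moves n X))"
proof -
  have "saturated {path_graph 4} (complete_graph n) (position (complete_graph n) X)
      \<longleftrightarrow> P4_moves n X = {}"
    by (rule saturated_iff_no_moves)
      (use edges_in P4_free family_free_iff_P4_free in \<open>auto simp: simple_graph_def complete_graph_def\<close>)
  moreover have "finite (edges (complete_graph n))"
    by (simp add: complete_graph_def finite_imp_finite_nsets)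
  ultimately show
    "P4_value n Prolonger X = (if P4_moves n X = {} then 0
     else 1 + Max ((\<lambda>e. P4_value n Shortener (insert e X)) ` P4_moves n X))"
    "P4_value n Shortener X = (if P4_moves n X = {} then 0
     else 1 + Min ((\<lambda>e. P4_value n Prolonger (insert e X)) ` P4_moves n X))"
    by (simp_all add: remaining_length.simps[of "{path_graph 4}" "complete_graph n" X])
qed

section \<open>Optimal moves and chosen moves\<close>

text \<open>Used for the player against whom a bound is proved: some move attains the maximum or
  minimum, and the bound must then be checked for every possible step.\<close>

lemma value_cases:
  obtains (stuck) "P4_value n p X = 0" "\<And>c. \<not> step (counts {..<n} X) c"
  | (move) Y where "P4_position n Y" "step (counts {..<n} X) (counts {..<n} Y)"
      "P4_value n p X = Suc (P4_value n (opponent p) Y)"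
proof (cases "P4_moves n X = {}")
  case True
  then have "P4_value n p X = 0" using value_eq by (cases p) auto
  moreover have "\<not> step (counts {..<n} X) c" for c
    using True obtain_move by blast
  ultimately show ?thesis by (rule stuck)
next
  case False
  have "\<exists>e \<in> P4_moves n X. P4_value n p X = Suc (P4_value n (opponent p) (insert e X))"
  proof (cases p)
    case Prolonger
    have "Max ((\<lambda>e. P4_value n Shortener (insert e X)) ` P4_moves n X)
        \<in> (\<lambda>e. P4_value n Shortener (insert e X)) ` P4_moves n X"
      by (rule Max_in) (use False finite_moves in auto)
    then show ?thesis using False Prolonger value_eq(1) by auto
  next
    case Shortener
    have "Min ((\<lambda>e. P4_value n Prolonger (insert e X)) ` P4_moves n X)
        \<in> (\<lambda>e. P4_value n Prolonger (insert e X)) ` P4_moves n X"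
      by (rule Min_in) (use False finite_moves in auto)
    then show ?thesis using False Shortener value_eq(2) by auto
  qed
  then show ?thesis using move position_insert by blast
qed

text \<open>Used for the player whose strategy proves a bound: any step of choice bounds the value
  from one side. \<open>Shortener_choice\<close> is the counterpart.\<close>

lemma Prolonger_choice:
  assumes "step (counts {..<n} X) c"
  obtains Y where "P4_position n Y" "counts {..<n} Y = c"
    "Suc (P4_value n Shortener Y) \<le> P4_value n Prolonger X"
proof -
  obtain e where e: "e \<in> P4_moves n X" "counts {..<n} (insert e X) = c"
    using obtain_move assms by blast
  then have "P4_value n Shortener (insert e X)
      \<le> Max ((\<lambda>e. P4_value n Shortener (insert e X)) ` P4_moves n X)"
    using finite_moves by (intro Max_ge) auto
  then show ?thesis
    using that[of "insert e X"] e position_insert(1)[OF e(1)] value_eq(1) by (auto split: if_splits)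
qed

lemma Shortener_choice:
  assumes "step (counts {..<n} X) c"
  obtains Y where "P4_position n Y" "counts {..<n} Y = c"
    "P4_value n Shortener X \<le> Suc (P4_value n Prolonger Y)"
proof -
  obtain e where e: "e \<in> P4_moves n X" "counts {..<n} (insert e X) = c"
    using obtain_move assms by blast
  then have "Min ((\<lambda>e. P4_value n Prolonger (insert e X)) ` P4_moves n X)
      \<le> P4_value n Prolonger (insert e X)"
    using finite_moves by (intro Min_le) auto
  then show ?thesis
    using that[of "insert e X"] e position_insert(1)[OF e(1)] value_eq(2) by (auto split: if_splits)
qed

end

section \<open>Bounds on the length by induction\<close>

text \<open>Every rule except \<open>new_triangle\<close> consumes an isolated vertex, so only the
  closing of the \<open>b\<close> cherries remains, however the game is played.\<close>

lemma P4_value_no_isolated: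
  assumes "P4_position n X" "counts {..<n} X = (0, a, b, s)"
  shows "P4_value n p X = b"
  using assms
proof (induction b arbitrary: X p)
  case 0
  interpret P4_position n X by fact
  show ?case
    by (rule value_cases[of p]) (use 0 in \<open>auto elim: step.cases\<close>)
next
  case (Suc b)
  interpret P4_position n X by fact
  show ?case
  proof (cases rule: value_cases[of p])
    case stuck
    then show ?thesis using Suc.prems new_triangle by metis
  next
    case (move Y)
    then have "counts {..<n} Y = (0, a, b, s)"
      using Suc.prems by (auto elim: step.cases)
    then show ?thesis using Suc.IH move by simp
  qed
qed

text \<open>Shortener destroys each cherry at once, so at most one is present on Shortener's turn
  and none on Prolonger's. Relative to the weight, the allowed excess is 5 for Prolonger's turn and
  4 or 3 for Shortener's turn with \<open>b = 0\<close> or \<open>b = 1\<close>. Prolonger's new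
  cherries and enlarged stars, and Shortener's new edges and destroyed cherries, all balance it
  exactly. The measure \<open>3 * i + 2 * a + b\<close> drops in every step.\<close>

lemma P4_value_upper:
  assumes "P4_position n X" "counts {..<n} X = (i, a, b, s)"
  shows "(b = 0 \<longrightarrow> 5 * P4_value n Prolonger X \<le> 4 * i + 2 * a + 5) \<and>
    (b = 0 \<longrightarrow> 5 * P4_value n Shortener X \<le> 4 * i + 2 * a + 4) \<and>
    (b = 1 \<longrightarrow> 5 * P4_value n Shortener X \<le> 4 * i + 2 * a + 6)"
  using assms
proof (induction "3 * i + 2 * a + b" arbitrary: X i a b s rule: less_induct)
  case less
  interpret P4_position n X by fact
  note counts = less.prems(2)
  have Prolonger_turn: "5 * P4_value n Prolonger X \<le> 4 * i + 2 * a + 5" if b: "b = 0"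
  proof (cases rule: value_cases[of Prolonger])
    case (move Y)
    obtain i' a' b' s' where Y: "counts {..<n} Y = (i', a', b', s')" by (metis prod_cases4)
    have "step (i, a, 0, s) (i', a', b', s')" using move(2) counts Y b by simp
    then show ?thesis
      using less.hyps[OF _ move(1) Y] move(3) b by cases auto
  qed simp
  have Shortener_turn_0: "5 * P4_value n Shortener X \<le> 4 * i + 2 * a + 4" if b: "b = 0"
  proof -
    \<comment> \<open>With two isolated vertices Shortener joins them. With at most one, the rest of
      the game is short enough to be bounded directly.\<close>
    consider (large) i' where "i = Suc (Suc i')" | (zero) "i = 0" | (star) "i = 1" "s"
      | (edge) a' where "i = 1" "a = Suc a'" | (stuck) "i = 1" "\<not> s" "a = 0"
      by (metis One_nat_def not0_implies_Suc)
    then show ?thesis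
    proof cases
      case large
      then have "step (counts {..<n} X) (i', Suc a, 0, s)"
        using counts b by (simp add: step.intros)
      then obtain Y where Y: "P4_position n Y" "counts {..<n} Y = (i', Suc a, 0, s)"
        "P4_value n Shortener X \<le> Suc (P4_value n Prolonger Y)"
        by (rule Shortener_choice)
      then show ?thesis using less.hyps[OF _ Y(1,2)] large by auto
    next
      case zero
      then show ?thesis using P4_value_no_isolated[OF less.prems(1)] counts b by simp
    next
      case star
      then have "step (counts {..<n} X) (0, a, 0, True)"
        using counts b by (simp add: step.intros)
      then obtain Y where Y: "P4_position n Y" "counts {..<n} Y = (0, a, 0, True)"
        "P4_value n Shortener X \<le> Suc (P4_value n Prolonger Y)"
        by (rule Shortener_choice)
      then show ?thesis using P4_value_no_isolated[OF Y(1,2)] star by simp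
    next
      \<comment> \<open>The last isolated vertex makes a cherry, which is then closed: two moves,
        for which the offset 4 is tight when \<open>a' = 0\<close>.\<close>
      case edge
      then have "step (counts {..<n} X) (0, a', 1, s)"
        using counts b by (simp add: step.intros)
      then obtain Y where Y: "P4_position n Y" "counts {..<n} Y = (0, a', 1, s)"
        "P4_value n Shortener X \<le> Suc (P4_value n Prolonger Y)"
        by (rule Shortener_choice)
      then show ?thesis using P4_value_no_isolated[OF Y(1,2)] edge by simp
    next
      case stuck
      have "\<not> step (counts {..<n} X) c" for c
        unfolding counts using stuck b by (auto elim: step.cases)
      then have "P4_value n Shortener X = 0" by (metis value_cases)
      then show ?thesis by simp
    qed
  qed
  have Shortener_turn_1: "5 * P4_value n Shortener X \<le> 4 * i + 2 * a + 6" if b: "b = 1"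
  proof (cases i)
    case 0
    then show ?thesis using P4_value_no_isolated[OF less.prems(1)] counts b by simp
  next
    case (Suc i')
    then have "step (counts {..<n} X) (i', a, 0, True)"
      using counts b by (simp add: step.intros)
    then obtain Y where Y: "P4_position n Y" "counts {..<n} Y = (i', a, 0, True)"
      "P4_value n Shortener X \<le> Suc (P4_value n Prolonger Y)"
      by (rule Shortener_choice)
    then show ?thesis using less.hyps[OF _ Y(1,2)] Suc b by simp
  qed
  from Prolonger_turn Shortener_turn_0 Shortener_turn_1 show ?case by blast
qed

text \<open>The second alternatives cover positions with so many single edges that the isolated vertices
  run out before they are used up: there the weight overestimates the remaining length.\<close>

lemma P4_value_lower:
  assumes "P4_position n X" "counts {..<n} X = (i, a, b, s)"
  shows "(4 * i + 2 * a + 3 * b \<le> 5 * P4_value n Prolonger X + (if a = 0 \<and> b = 0 \<and> \<not> s then 8 else 4)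
      \<or> i + b \<le> P4_value n Prolonger X) \<and>
    (4 * i + 2 * a + 3 * b \<le> 5 * P4_value n Shortener X + (if b = 0 then 5 else 6)
      \<or> i + b \<le> P4_value n Shortener X + 1)"
  using assms
proof (induction "3 * i + 2 * a + b" arbitrary: X i a b s rule: less_induct)
  case less
  interpret P4_position n X by fact
  note counts = less.prems(2)
  \<comment> \<open>The offsets 4, 5 and 6 balance a new cherry or an enlarged star by Prolonger
    against a new edge or a destroyed cherry by Shortener. The offset 8 is for positions with only
    isolated vertices and triangles, where Prolonger has no move that gains.\<close>
  have "4 * i + 2 * a + 3 * b \<le> 5 * P4_value n Prolonger X + (if a = 0 \<and> b = 0 \<and> \<not> s then 8 else 4)
      \<or> i + b \<le> P4_value n Prolonger X"
  proof -
    consider (zero) "i = 0" | (edge) i' a' where "i = Suc i'" "a = Suc a'"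
      | (close) b' where "a = 0" "b = Suc b'" | (star) i' where "i = Suc i'" "a = 0" "b = 0" "s"
      | (start) i' where "i = Suc (Suc i')" "a = 0" "b = 0" "\<not> s"
      | (stuck) "i = 1" "a = 0" "b = 0" "\<not> s"
      by (metis One_nat_def not0_implies_Suc)
    then show ?thesis
    proof cases
      case zero
      then show ?thesis using P4_value_no_isolated[OF less.prems(1)] counts by simp
    next
      case edge
      then have "step (counts {..<n} X) (i', a', Suc b, s)"
        using counts by (simp add: step.intros)
      then obtain Y where Y: "P4_position n Y" "counts {..<n} Y = (i', a', Suc b, s)"
        "Suc (P4_value n Shortener Y) \<le> P4_value n Prolonger X"
        by (rule Prolonger_choice)
      then show ?thesis using less.hyps[OF _ Y(1,2)] edge by auto
    next
      \<comment> \<open>The second alternative for the successor gives only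
        \<open>i + b - 1\<close>, one less than its analogue here. As \<open>a = 0\<close>, the
        weight is \<open>4 * i + 3 * b\<close>, and the first alternative follows.\<close>
      case close
      then have "step (counts {..<n} X) (i, 0, b', s)"
        using counts by (simp add: step.intros)
      then obtain Y where Y: "P4_position n Y" "counts {..<n} Y = (i, 0, b', s)"
        "Suc (P4_value n Shortener Y) \<le> P4_value n Prolonger X"
        by (rule Prolonger_choice)
      then show ?thesis using less.hyps[OF _ Y(1,2)] close by (auto split: if_splits)
    next
      case star
      then have "step (counts {..<n} X) (i', 0, 0, True)"
        using counts by (simp add: step.intros)
      then obtain Y where Y: "P4_position n Y" "counts {..<n} Y = (i', 0, 0, True)"
        "Suc (P4_value n Shortener Y) \<le> P4_value n Prolonger X"
        by (rule Prolonger_choice)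
      then show ?thesis using less.hyps[OF _ Y(1,2)] star by auto
    next
      \<comment> \<open>Prolonger is forced to join two isolated vertices. This costs 6 of the
        weight, and Shortener's offset 5 grows to 6, within the permitted 8.\<close>
      case start
      then have "step (counts {..<n} X) (i', 1, 0, s)"
        using counts by (simp add: step.intros)
      then obtain Y where Y: "P4_position n Y" "counts {..<n} Y = (i', 1, 0, s)"
        "Suc (P4_value n Shortener Y) \<le> P4_value n Prolonger X"
        by (rule Prolonger_choice)
      then show ?thesis using less.hyps[OF _ Y(1,2)] start by auto
    qed simp
  qed
  moreover have "4 * i + 2 * a + 3 * b \<le> 5 * P4_value n Shortener X + (if b = 0 then 5 else 6)
      \<or> i + b \<le> P4_value n Shortener X + 1"
  proof (cases rule: value_cases[of Shortener])
    case stuck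
    have "i < 2"
    proof (rule ccontr)
      assume "\<not> i < 2"
      then have "i = Suc (Suc (i - 2))" by simp
      then have "step (counts {..<n} X) (i - 2, Suc a, b, s)"
        unfolding counts by (metis new_edge)
      then show False using stuck(2) by simp
    qed
    moreover have "b = 0"
      using stuck(2) new_triangle counts by (metis not0_implies_Suc)
    ultimately show ?thesis by simp
  next
    case (move Y)
    obtain i' a' b' s' where Y: "counts {..<n} Y = (i', a', b', s')" by (metis prod_cases4)
    \<comment> \<open>No step lowers \<open>i + b\<close> by more than 2, which carries the second
      alternative over. For the first, the offset 8 at \<open>Y\<close> arises only when the last
      cherry is closed; this lowers the weight by 3, and 8 + 3 - 5 is the offset 6 for
      \<open>b > 0\<close>.\<close>
    have "step (i, a, b, s) (i', a', b', s')" using move(2) counts Y by simp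
    then show ?thesis
      using less.hyps[OF _ move(1) Y] move(3) by cases (auto split: if_splits)
  qed
  ultimately show ?case by blast
qed

theorem theorem2:
  fixes n :: nat and first_player :: player
  assumes "n > 0"
  shows "4 / 5 * real n - 8 / 5
           \<le> real (game_saturation_number (complete_graph n) {path_graph 4} first_player)
       \<and> real (game_saturation_number (complete_graph n) {path_graph 4} first_player)
           \<le> 4 / 5 * real n + 1"
proof -
  have pos: "P4_position n {}"
    by unfold_locales (auto simp: P4_free_def nbrs_def)
  have counts: "counts {..<n} {} = (n, 0, 0, False)"
    by (simp add: counts_def isolated_def lone_edges_def lone_edge_def cherries_def cherry_def
        has_big_star_def nbrs_def)
  let ?v = "game_saturation_number (complete_graph n) {path_graph 4} first_player"
  \<comment> \<open>The empty graph has weight \<open>4 * n\<close>. If the second alternative of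
    the lower bound holds, then \<open>n \<le> ?v + 1\<close>, which also suffices.\<close>
  have "4 * n \<le> 5 * ?v + 8" "5 * ?v \<le> 4 * n + 5"
    using P4_value_lower[OF pos counts] P4_value_upper[OF pos counts] assms
    by (cases first_player; auto simp: game_saturation_number_def)+
  then have "4 * real n \<le> 5 * real ?v + 8" "5 * real ?v \<le> 4 * real n + 5"
    by (simp_all flip: of_nat_le_iff[where ?'a = real])
  then show ?thesis by simp
qed

end
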